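(* Let $\mathbb{F}_q$ be a finite field. Let $W$ be a weighing matrix $\mathrm{W}(n,m)$, let $B$ be the $n\times b$ point-by-block incidence matrix of an $(r,\lambda)$-design, and let $G=[\,W \mid B\,]$ be the $n\times(n+b)$ matrix over $\mathbb{F}_q$ obtained by juxtaposing $W$ and $B$ (with entries interpreted in $\mathbb{F}_q$). If $r+(n-1)\lambda+m\neq 0$ and $r-\lambda+m\neq 0$ in $\mathbb{F}_q$, then $G$ generates an LCD code $C$ of length $n+b$ over $\mathbb{F}_q$.
   Context: A weighing matrix $\mathrm{W}(n,m)$ is an $n\times n$ matrix $W$ with entries in $\{0,1,-1\}$ such that $WW^{\top}=mI_n$ over $\mathbb{C}$. An $(r,\lambda)$-design is a pair $(\mathcal{V},\mathcal{B})$, where $\mathcal{V}$ is a finite set of points and $\mathcal{B}$ is a collection of $b$ subsets of $\mathcal{V}$ (blocks), such that each point lies in exactly $r$ blocks and every pair of distinct points lies together in exactly $\lambda$ blocks. Its point-by-block incidence matrix is the $(0,1)$-matrix with rows indexed by points, columns indexed by blocks, and entry $1$ exactly when the point lies in the block. Entries $0,\pm1$ and integers are interpreted in $\mathbb{F}_q$. A matrix over $\mathbb{F}_q$ generates the linear code spanned by its rows. For a linear code $C\subseteq\mathbb{F}_q^N$, $C^\perp$ is its orthogonal complement under the standard inner product, and $C$ is LCD (linear with complementary dual) if $C\cap C^\perp=\{0\}$. *)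

theory Defs
  imports Complex_Main "HOL-Library.Multiset" "Jordan_Normal_Form.VS_Connect"
begin

definition weighing_matrix :: "nat \<Rightarrow> nat \<Rightarrow> int mat \<Rightarrow> bool" where
  "weighing_matrix n m W \<longleftrightarrow>
     W \<in> carrier_mat n n \<and>
     elements_mat W \<subseteq> {0, 1, -1} \<and>
     map_mat complex_of_int W * (map_mat complex_of_int W)\<^sup>T = of_nat m \<cdot>\<^sub>m 1\<^sub>m n"

(* Blocks form a multiset, so repeated blocks are allowed and counted with multiplicity. *)
definition r_lambda_design ::
  "nat \<Rightarrow> nat \<Rightarrow> 'p set \<Rightarrow> 'p set multiset \<Rightarrow> bool" where
  "r_lambda_design r l V \<B> \<longleftrightarrow>
     finite V \<and>
     (\<forall>bl \<in># \<B>. bl \<subseteq> V) \<and>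
     (\<forall>x \<in> V. size {#bl \<in># \<B>. x \<in> bl#} = r) \<and>
     (\<forall>x \<in> V. \<forall>y \<in> V. x \<noteq> y \<longrightarrow> size {#bl \<in># \<B>. x \<in> bl \<and> y \<in> bl#} = l)"

definition inc_mat_of :: "'p list \<Rightarrow> 'p set list \<Rightarrow> int mat" where
  "inc_mat_of vs bs =
     mat (length vs) (length bs) (\<lambda>(i, j). if vs ! i \<in> bs ! j then 1 else 0)"

(* An incidence matrix depends on an ordering of the points and of the blocks;
   every ordering is admitted. *)
definition is_incidence_matrix ::
  "'p set \<Rightarrow> 'p set multiset \<Rightarrow> int mat \<Rightarrow> bool" where
  "is_incidence_matrix V \<B> B \<longleftrightarrow>
     (\<exists>vs bs. distinct vs \<and> set vs = V \<and> mset bs = \<B> \<and> B = inc_mat_of vs bs)"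

(* [A | B], encoded as a block matrix whose lower blocks have no rows;
   intended for dim_row A = dim_row B. *)
definition append_cols :: "'a::zero mat \<Rightarrow> 'a mat \<Rightarrow> 'a mat" where
  "append_cols A B = four_block_mat A B (0\<^sub>m 0 (dim_col A)) (0\<^sub>m 0 (dim_col B))"

definition linear_code :: "nat \<Rightarrow> 'a::{field,finite} vec set \<Rightarrow> bool" where
  "linear_code N C \<longleftrightarrow> VectorSpace.subspace class_ring C (module_vec TYPE('a) N)"

definition lcd_code :: "nat \<Rightarrow> 'a::{field,finite} vec set \<Rightarrow> bool" where
  "lcd_code N C \<longleftrightarrow> linear_code N C \<and> C \<inter> vec_module.orthogonal_complement N C = {0\<^sub>v N}"

definition generated_code :: "'a::{field,finite} mat \<Rightarrow> 'a vec set" where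
  "generated_code G = vec_space.row_space (dim_col G) G"

end

theory Submission
  imports Defs
begin

text \<open>
  The Gram matrix of \<open>G\<close> is \<open>G * G\<^sup>T = (r - l + m) I + l J\<close>, where \<open>J\<close> is the all-one matrix.
  A codeword \<open>G\<^sup>T x\<close> orthogonal to the whole code satisfies \<open>G * G\<^sup>T x = 0\<close>. Summing the
  entries of this equation gives \<open>(r + (n - 1) l + m) (\<Sum>i. x i) = 0\<close>, so the entries of \<open>x\<close> sum
  to zero; then \<open>(r - l + m) x = 0\<close>, so \<open>x = 0\<close>.
\<close>

lemma row_append_cols:
  assumes "A \<in> carrier_mat n k" "B \<in> carrier_mat n l" "i < n"
  shows "row (append_cols A B) i = row A i @\<^sub>v row B i"
  unfolding append_cols_def using assms by (subst row_four_block_mat(1)) auto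

lemma append_cols_carrier [simp]:
  assumes "A \<in> carrier_mat n k" "B \<in> carrier_mat n l"
  shows "append_cols A B \<in> carrier_mat n (k + l)"
  using assms unfolding append_cols_def by auto

text \<open>Every entry is an inner product of two concatenated rows, and such a product splits at
  column \<open>k\<close>.\<close>

lemma append_cols_mult_transpose:
  fixes A B C D :: "'a::comm_ring_1 mat"
  assumes A: "A \<in> carrier_mat n k" and B: "B \<in> carrier_mat n l"
    and C: "C \<in> carrier_mat p k" and D: "D \<in> carrier_mat p l"
  shows "append_cols A B * (append_cols C D)\<^sup>T = A * C\<^sup>T + B * D\<^sup>T"
proof (rule eq_matI)
  note AB = append_cols_carrier[OF A B] and CD = append_cols_carrier[OF C D]
  fix i j
  assume "i < dim_row (A * C\<^sup>T + B * D\<^sup>T)" "j < dim_col (A * C\<^sup>T + B * D\<^sup>T)"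
  then have i: "i < n" and j: "j < p"
    using B D by auto
  have "(append_cols A B * (append_cols C D)\<^sup>T) $$ (i, j)
      = row (append_cols A B) i \<bullet> row (append_cols C D) j"
    using i j AB CD by auto
  also have "\<dots> = (row A i @\<^sub>v row B i) \<bullet> (row C j @\<^sub>v row D j)"
    using row_append_cols[OF A B i] row_append_cols[OF C D j] by simp
  also have "\<dots> = row A i \<bullet> row C j + row B i \<bullet> row D j"
    using A B C D by (intro scalar_prod_append[of _ k _ l]) auto
  also have "\<dots> = (A * C\<^sup>T + B * D\<^sup>T) $$ (i, j)"
    using i j A B C D by auto
  finally show "(append_cols A B * (append_cols C D)\<^sup>T) $$ (i, j) = (A * C\<^sup>T + B * D\<^sup>T) $$ (i, j)" .
qed (use append_cols_carrier[OF A B] append_cols_carrier[OF C D] B D in auto)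

lemma map_mat_append_cols:
  assumes "dim_row A = dim_row B" "f 0 = 0"
  shows "map_mat f (append_cols A B) = append_cols (map_mat f A) (map_mat f B)"
  using assms unfolding append_cols_def by (intro eq_matI) auto

lemma inc_mat_of_carrier [simp]: "inc_mat_of vs bs \<in> carrier_mat (length vs) (length bs)"
  unfolding inc_mat_of_def by simp

text \<open>A product of two 0/1 entries in one column is 1 exactly when that block contains both
  points. The case \<open>i = j\<close> is included and gives the number of blocks through one
  point.\<close>

lemma inc_mat_of_gram:
  assumes "i < length vs" "j < length vs"
  shows "(inc_mat_of vs bs * (inc_mat_of vs bs)\<^sup>T) $$ (i, j)
    = int (size {#bl \<in># mset bs. vs ! i \<in> bl \<and> vs ! j \<in> bl#})"
proof -
  let ?P = "\<lambda>bl. vs ! i \<in> bl \<and> vs ! j \<in> bl"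
  have "(inc_mat_of vs bs * (inc_mat_of vs bs)\<^sup>T) $$ (i, j)
      = (\<Sum>t = 0..<length bs. if ?P (bs ! t) then 1 else 0)"
    using assms by (auto simp: inc_mat_of_def scalar_prod_def intro!: sum.cong)
  also have "\<dots> = int (card {t. t < length bs \<and> ?P (bs ! t)})"
    by (simp add: sum.If_cases Int_def)
  also have "\<dots> = int (size {#bl \<in># mset bs. ?P bl#})"
    by (simp add: length_filter_conv_card flip: mset_filter)
  finally show ?thesis .
qed

text \<open>The defining identity lives over the complex numbers. As the integers embed injectively
  there, it descends to the integers, from where it can be mapped into any field.\<close>

lemma weighing_matrix_gram:
  assumes "weighing_matrix n m W"
  shows "W * W\<^sup>T = of_nat m \<cdot>\<^sub>m 1\<^sub>m n"
proof -
  have W: "W \<in> carrier_mat n n"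
    and eq: "map_mat complex_of_int W * (map_mat complex_of_int W)\<^sup>T = of_nat m \<cdot>\<^sub>m 1\<^sub>m n"
    using assms unfolding weighing_matrix_def by auto
  have "map_mat complex_of_int (of_nat m \<cdot>\<^sub>m 1\<^sub>m n) = of_nat m \<cdot>\<^sub>m 1\<^sub>m n"
    by (intro eq_matI) auto
  then have "map_mat complex_of_int (W * W\<^sup>T) = map_mat complex_of_int (of_nat m \<cdot>\<^sub>m 1\<^sub>m n)"
    using eq W by (subst of_int_hom.mat_hom_mult[of _ n n]) (auto simp: map_mat_transpose)
  then show ?thesis
    by (rule of_int_hom.mat_hom_inj)
qed

lemma r_lambda_design_gram:
  assumes design: "r_lambda_design r l V \<B>" and inc: "is_incidence_matrix V \<B> B"
  shows "B \<in> carrier_mat (card V) (size \<B>)"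
    and "B * B\<^sup>T = mat (card V) (card V) (\<lambda>(i, j). if i = j then int r else int l)"
proof -
  obtain vs bs where vs: "distinct vs" "set vs = V" and bs: "mset bs = \<B>" and B: "B = inc_mat_of vs bs"
    using inc unfolding is_incidence_matrix_def by auto
  have len: "length vs = card V" "length bs = size \<B>"
    using vs bs by (auto simp: distinct_card)
  show carrier: "B \<in> carrier_mat (card V) (size \<B>)"
    using B len inc_mat_of_carrier by metis
  show "B * B\<^sup>T = mat (card V) (card V) (\<lambda>(i, j). if i = j then int r else int l)"
  proof (rule eq_matI, goal_cases)
    case (1 i j)
    then have ij: "i < length vs" "j < length vs"
      using len by auto
    \<comment> \<open>Distinctness of \<open>vs\<close> makes off-diagonal positions belong to
      distinct points, where the pair condition of the design applies.\<close>
    then have V: "vs ! i \<in> V" "vs ! j \<in> V" and eq: "vs ! i = vs ! j \<longleftrightarrow> i = j"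
      using vs by (auto simp: nth_eq_iff_index_eq)
    show ?case
      unfolding B inc_mat_of_gram[OF ij] bs
      using 1 V eq design unfolding r_lambda_design_def by (cases "i = j") auto
  qed (use carrier in auto)
qed

text \<open>The sufficient half of Massey's criterion: a Gram matrix with trivial kernel gives an
  LCD code. Such a kernel also forces the rows of \<open>G\<close> to be independent.\<close>

lemma lcd_code_generated_codeI:
  fixes G :: "'a::{field,finite} mat"
  assumes G: "G \<in> carrier_mat n N"
    and ker: "\<And>x. x \<in> carrier_vec n \<Longrightarrow> (G * G\<^sup>T) *\<^sub>v x = 0\<^sub>v n \<Longrightarrow> x = 0\<^sub>v n"
  shows "lcd_code N (generated_code G)"
proof -
  interpret vec_space "TYPE('a)" N .
  have code: "generated_code G = row_space G"
    using G unfolding generated_code_def by simp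
  have rows: "set (rows G) \<subseteq> carrier_vec N"
    using G by (auto simp: rows_def)
  have sub: "VectorSpace.subspace class_ring (row_space G) V"
    unfolding row_space_def using span_is_subspace[OF rows] .
  have "v = 0\<^sub>v N" if v: "v \<in> row_space G" and orth: "v \<in> orthogonal_complement (row_space G)" for v
  proof -
    obtain x where x: "x \<in> carrier_vec n" and vx: "v = G\<^sup>T *\<^sub>v x"
      using v G by (auto simp: row_space_eq[OF G])
    have vc: "v \<in> carrier_vec N"
      using G x vx by auto
    have "v \<bullet> row G i = 0" if "i < n" for i
    proof -
      have "row G i \<in> row_space G"
        using that G in_own_span[OF rows] unfolding row_space_def by (auto simp: rows_def)
      then show ?thesis
        using orth unfolding orthogonal_complement_def by simp
    qed
    then have "G *\<^sub>v v = 0\<^sub>v n"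
      using G vc by (intro eq_vecI) (auto simp: comm_scalar_prod[of _ N])
    then have "(G * G\<^sup>T) *\<^sub>v x = 0\<^sub>v n"
      using G x vx by (subst assoc_mult_mat_vec[of _ n N]) auto
    then have "x = 0\<^sub>v n"
      using ker x by blast
    then show ?thesis
      using G vx by (intro eq_vecI) auto
  qed
  \<comment> \<open>The intersection must equal the zero space, so the zero vector has to be placed
    in both sets.\<close>
  moreover have "0\<^sub>v N \<in> row_space G"
    unfolding row_space_eq[OF G] using G by (auto intro!: bexI[of _ "0\<^sub>v n"] eq_vecI)
  moreover have "0\<^sub>v N \<in> orthogonal_complement (row_space G)"
    using G unfolding orthogonal_complement_def row_space_eq[OF G] by auto
  ultimately show ?thesis
    using sub unfolding lcd_code_def linear_code_def code by blast
qed

text \<open>The matrix is \<open>(a - c) I + c J\<close>, and the two nonzero quantities are its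
  eigenvalues on sum-zero vectors and on the all-one vector. Summing the equations avoids dividing
  by \<open>n\<close>, which may vanish in the field.\<close>

lemma constant_diagonal_mult_vec_eq_0:
  fixes a c :: "'a::field"
  assumes x: "x \<in> carrier_vec n"
    and eq: "mat n n (\<lambda>(i, j). if i = j then a else c) *\<^sub>v x = 0\<^sub>v n"
    and sum_ne: "a + (of_nat n - 1) * c \<noteq> 0" and diff_ne: "a - c \<noteq> 0"
  shows "x = 0\<^sub>v n"
proof -
  define s where "s = (\<Sum>j<n. x $ j)"
  have entry: "(a - c) * x $ i + c * s = 0" if i: "i < n" for i
  proof -
    have "0 = (mat n n (\<lambda>(i, j). if i = j then a else c) *\<^sub>v x) $ i"
      using eq i by simp
    also have "\<dots> = (\<Sum>j<n. (if i = j then a else c) * x $ j)"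
      using i x by (auto simp: scalar_prod_def lessThan_atLeast0 intro!: sum.cong)
    \<comment> \<open>Write the diagonal entry as \<open>(a - c) + c\<close>, so that
      \<open>c\<close> multiplies the full sum \<open>s\<close>.\<close>
    also have "\<dots> = (\<Sum>j<n. (if i = j then (a - c) * x $ j else 0) + c * x $ j)"
      by (intro sum.cong) (auto simp: algebra_simps)
    also have "\<dots> = (a - c) * x $ i + c * s"
      using i by (simp add: sum.distrib s_def sum_distrib_left)
    finally show ?thesis by simp
  qed
  \<comment> \<open>Adding all \<open>n\<close> row equations gives
    \<open>(a - c) * s + of_nat n * c * s\<close>.\<close>
  have "(a + (of_nat n - 1) * c) * s = (\<Sum>i<n. (a - c) * x $ i + c * s)"
    by (simp add: sum.distrib flip: sum_distrib_left s_def) (simp add: algebra_simps)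
  also have "\<dots> = 0"
    using entry by simp
  finally have "s = 0"
    using sum_ne by simp
  then show ?thesis
    using entry diff_ne x by (intro eq_vecI) auto
qed

theorem theorem3p4:
  fixes W B :: "int mat"
    and V :: "'p set" and \<B> :: "'p set multiset"
    and G :: "'a::{field,finite} mat"
    and n m r l b :: nat
  assumes "weighing_matrix n m W"
    and "r_lambda_design r l V \<B>"
    and "card V = n" and "size \<B> = b"
    and "is_incidence_matrix V \<B> B"
    and "G = append_cols (map_mat of_int W) (map_mat of_int B)"
    and "of_nat r + (of_nat n - 1) * of_nat l + of_nat m \<noteq> (0::'a)"
    and "of_nat r - of_nat l + of_nat m \<noteq> (0::'a)"
  shows "lcd_code (n + b) (generated_code G)"
proof -
  \<comment> \<open>\<open>H\<close> is the integer lift of \<open>G\<close>: its Gram matrix is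
    computed over the integers and then carried to the field by the ring homomorphism
    \<open>of_int\<close>.\<close>
  define H where "H = append_cols W B"
  have W: "W \<in> carrier_mat n n"
    using assms(1) unfolding weighing_matrix_def by simp
  have B: "B \<in> carrier_mat n b"
    and BB: "B * B\<^sup>T = mat n n (\<lambda>(i, j). if i = j then int r else int l)"
    using r_lambda_design_gram[OF assms(2,5)] assms(3,4) by auto
  have H: "H \<in> carrier_mat n (n + b)"
    unfolding H_def using W B by simp
  have GH: "G = map_mat of_int H"
    unfolding assms(6) H_def using W B by (subst map_mat_append_cols) auto
  have "H * H\<^sup>T = W * W\<^sup>T + B * B\<^sup>T"
    unfolding H_def by (rule append_cols_mult_transpose[OF W B W B])
  then have HH: "H * H\<^sup>T = mat n n (\<lambda>(i, j). if i = j then int r + int m else int l)"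
    unfolding weighing_matrix_gram[OF assms(1)] BB by (auto intro!: eq_matI)
  have "G * G\<^sup>T = map_mat of_int (H * H\<^sup>T)"
    unfolding GH using H
    by (subst of_int_hom.mat_hom_mult[of _ n "n + b"]) (auto simp: map_mat_transpose)
  also have "\<dots> = mat n n (\<lambda>(i, j). if i = j then of_nat r + of_nat m else of_nat l)"
    unfolding HH by (auto intro!: eq_matI)
  finally have GG: "G * G\<^sup>T = mat n n (\<lambda>(i, j). if i = j then of_nat r + of_nat m else of_nat l)" .
  show ?thesis
  proof (rule lcd_code_generated_codeI)
    show "G \<in> carrier_mat n (n + b)"
      unfolding GH using H by simp
    show "x = 0\<^sub>v n" if "x \<in> carrier_vec n" "(G * G\<^sup>T) *\<^sub>v x = 0\<^sub>v n" for x
      \<comment> \<open>Here \<open>a\<close> is \<open>r + m\<close> and \<open>c\<close> is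
        \<open>l\<close>, which turns the two nonvanishing conditions into the assumptions on the
        parameters.\<close>
      using constant_diagonal_mult_vec_eq_0[OF that(1) that(2)[unfolded GG]] assms(7,8)
      by (simp add: algebra_simps)
  qed
qed

end
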